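(* Let $S=\bigcap_{Q} Q_{MS}$, where the intersection is over all simple sets of polynomials $Q$ and $Q_{MS}$ denotes the set of $Q$-multiplier sequences. If $\{\gamma_k\}_{k=0}^\infty\in S$, then one of the following holds: (i) $\{\gamma_k\}_{k=0}^\infty$ is a constant sequence, or (ii) $\{\gamma_k\}_{k=0}^\infty=\{\gamma_0,\gamma_1,0,0,0,\ldots\}$, i.e. $\gamma_k=0$ for all $k\ge 2$.
   Context: All polynomials have real coefficients. A simple set of polynomials is a sequence $Q=\{q_k(x)\}_{k=0}^\infty$ of real polynomials with $\deg q_k=k$ for $k=0,1,2,\ldots$ (so $q_0$ is a nonzero constant, and $Q$ is a basis of $\mathbb{R}[x]$). A polynomial "has only real zeros" if it has no non-real complex zeros or is identically zero (nonzero constants also qualify). A sequence of real numbers $\{\gamma_k\}_{k=0}^\infty$ is a $Q$-multiplier sequence if, for every $n$ and all real $a_0,\ldots,a_n$, the polynomial $\sum_{k=0}^n a_k\gamma_k q_k(x)$ has only real zeros whenever $\sum_{k=0}^n a_k q_k(x)$ has only real zeros. *)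

theory Defs
  imports Complex_Main "HOL-Computational_Algebra.Polynomial"
begin

definition simple_set :: "(nat \<Rightarrow> real poly) \<Rightarrow> bool" where
  "simple_set q \<longleftrightarrow> (\<forall>k. q k \<noteq> 0 \<and> degree (q k) = k)"

text \<open>The zero polynomial counts as having only real zeros.\<close>

definition only_real_zeros :: "real poly \<Rightarrow> bool" where
  "only_real_zeros p \<longleftrightarrow>
     p = 0 \<or> (\<forall>z::complex. poly (map_poly complex_of_real p) z = 0 \<longrightarrow> z \<in> \<real>)"

text \<open>Only the values \<open>a 0, \<dots>, a n\<close> of the coefficient function matter.\<close>

definition multiplier_sequences :: "(nat \<Rightarrow> real poly) \<Rightarrow> (nat \<Rightarrow> real) set" where
  "multiplier_sequences q =
     {\<gamma>. \<forall>(n::nat) (a::nat \<Rightarrow> real).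
        only_real_zeros (\<Sum>k\<le>n. smult (a k) (q k)) \<longrightarrow>
        only_real_zeros (\<Sum>k\<le>n. smult (a k * \<gamma> k) (q k))}"

end

theory Submission
  imports Defs
begin

text \<open>
  Membership in every \<open>multiplier_sequences q\<close> is a strong condition because the basis may be
  chosen to suit the sequence. Given \<open>j < k\<close> and polynomials \<open>p\<close> and \<open>r\<close> of degrees \<open>k\<close> and
  \<open>j\<close>, some simple set contains \<open>r\<close> and \<open>p - r\<close>. With respect to this basis,
  \<open>p = (p - r) + r\<close> has only two coordinates, so \<open>\<gamma>\<close> sends \<open>p\<close> to
  \<open>\<gamma> k (p - r) + \<gamma> j r\<close>. If \<open>p\<close> has only real zeros, then so must this image
  (\<open>two_term_image_real\<close>). Take \<open>p = x ^ k\<close> and let \<open>r\<close> vary.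

  If \<open>\<gamma> k = 0\<close>, the image is \<open>\<gamma> j r\<close>, and for \<open>j \<ge> 2\<close> some \<open>r\<close> of degree \<open>j\<close> has a non-real
  zero; thus a zero of \<open>\<gamma>\<close> forces \<open>\<gamma> j = 0\<close> at all earlier indices \<open>j \<ge> 2\<close>. If \<open>\<gamma> k \<noteq> 0\<close>
  and \<open>\<gamma> j \<noteq> \<gamma> k\<close>, then, after rescaling \<open>r\<close>, the image is a nonzero multiple of \<open>x ^ k + r\<close>,
  and for \<open>k \<ge> 2\<close> a perturbation \<open>r\<close> of any prescribed degree below \<open>k\<close> can create a non-real
  zero (\<open>nonreal_perturbation\<close>); thus \<open>\<gamma>\<close> is constant up to any index \<open>k \<ge> 2\<close> at which it
  does not vanish. By the first fact, one such index makes all later ones nonvanishing too, and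
  then the second fact makes \<open>\<gamma>\<close> constant.
\<close>

lemma only_real_zeros_monom: "only_real_zeros (monom 1 k)"
  by (auto simp: only_real_zeros_def map_poly_monom poly_monom)

lemma only_real_zeros_smultD:
  assumes "only_real_zeros (smult c p)" "c \<noteq> 0"
  shows "only_real_zeros p"
  using assms by (auto simp: only_real_zeros_def map_poly_smult)

lemma map_poly_complex_of_real_add:
  "map_poly complex_of_real (p + q) = map_poly complex_of_real p + map_poly complex_of_real q"
  by (simp add: poly_eq_iff coeff_map_poly)

text \<open>
  A gap of length at least two below the leading term allows the factor \<open>x ^ (k - j) + 1\<close>,
  which vanishes at the non-real number \<open>cis (pi / (k - j))\<close>. For \<open>j = k - 1\<close> this factor would
  be linear, and a quadratic factor with zeros \<open>- 1 \<plusminus> \<i>\<close> takes its place.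
\<close>
lemma nonreal_perturbation:
  assumes "j < k" "2 \<le> k"
  obtains r :: "real poly"
    where "r \<noteq> 0" "degree r = j" "\<not> only_real_zeros (monom 1 k + r)"
proof (cases "k = Suc j")
  case True
  define i where "i = j - 1"
  have j: "j = Suc i" and k: "k = Suc (Suc i)"
    using True assms by (auto simp: i_def)
  define r :: "real poly" where "r = monom 2 j + monom 2 i"
  have deg: "degree r = j"
    unfolding r_def by (subst degree_add_eq_left) (auto simp: degree_monom_eq j)
  let ?z = "Complex (- 1) 1"
  have "?z ^ 2 + 2 * ?z + 2 = 0"
    by (simp add: complex_eq_iff power2_eq_square)
  then have "?z ^ i * (?z ^ 2 + 2 * ?z + 2) = 0"
    by simp
  then have "poly (map_poly complex_of_real (monom 1 k + r)) ?z = 0"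
    by (simp add: r_def map_poly_complex_of_real_add map_poly_monom poly_monom j k
        power2_eq_square algebra_simps)
  moreover have "?z \<notin> \<real>"
    by (simp add: complex_is_Real_iff)
  moreover have "monom 1 k + r \<noteq> 0"
    using assms deg by (metis add_cancel_left_left add_eq_0_iff degree_minus degree_monom_eq
        less_irrefl one_neq_zero)
  ultimately have "\<not> only_real_zeros (monom 1 k + r)"
    unfolding only_real_zeros_def by blast
  moreover have "r \<noteq> 0"
    using deg j by auto
  ultimately show ?thesis
    using deg that by blast
next
  case False
  define d where "d = k - j"
  have d: "2 \<le> d" and k: "k = j + d"
    using False assms by (auto simp: d_def)
  define r :: "real poly" where "r = monom 1 j"
  have deg: "degree r = j" and r0: "r \<noteq> 0"
    by (auto simp: r_def degree_monom_eq)
  let ?z = "cis (pi / real d)"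
  have "?z ^ d + 1 = 0"
    using d by (simp add: DeMoivre)
  then have "?z ^ j * (?z ^ d + 1) = 0"
    by simp
  then have "poly (map_poly complex_of_real (monom 1 k + r)) ?z = 0"
    by (simp add: r_def map_poly_complex_of_real_add map_poly_monom poly_monom k
        power_add algebra_simps)
  moreover have "sin (pi / real d) > 0"
    using d by (intro sin_gt_zero) (auto simp: field_simps)
  then have "?z \<notin> \<real>"
    by (simp add: complex_is_Real_iff)
  moreover have "monom 1 k + r \<noteq> 0"
    using assms deg by (metis add_eq_0_iff degree_minus degree_monom_eq
        less_irrefl one_neq_zero)
  ultimately have "\<not> only_real_zeros (monom 1 k + r)"
    unfolding only_real_zeros_def by blast
  then show ?thesis
    using deg r0 that by blast
qed

text \<open>
  The simple set used here has \<open>r\<close> in place \<open>j\<close> and \<open>p - r\<close> in place \<open>k\<close>; the other entries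
  carry the coefficient zero and only have to have the right degree.
\<close>
lemma two_term_image_real:
  assumes ms: "\<And>q. simple_set q \<Longrightarrow> \<gamma> \<in> multiplier_sequences q"
    and jk: "j < k"
    and p: "degree p = k" "only_real_zeros p"
    and r: "r \<noteq> 0" "degree r = j"
  shows "only_real_zeros (smult (\<gamma> k) (p - r) + smult (\<gamma> j) r)"
proof -
  define q where "q i = (if i = j then r else if i = k then p - r else monom 1 i)" for i
  define a :: "nat \<Rightarrow> real" where "a i = (if i = j \<or> i = k then 1 else 0)" for i
  have deg: "degree (p - r) = k"
    using p(1) r(2) jk
    by (metis add_uminus_conv_diff degree_add_eq_left degree_minus)
  have "simple_set q"
    unfolding simple_set_def using r deg jk by (auto simp: q_def degree_monom_eq)
  then have \<gamma>: "\<gamma> \<in> multiplier_sequences q"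
    by (rule ms)
  have two: "(\<Sum>i\<le>k. smult (a i * c i) (q i)) = smult (c k) (p - r) + smult (c j) r" for c
  proof -
    have "(\<Sum>i\<le>k. smult (a i * c i) (q i)) = (\<Sum>i\<in>{j, k}. smult (a i * c i) (q i))"
      using jk by (intro sum.mono_neutral_right) (auto simp: a_def)
    then show ?thesis
      using jk by (simp add: a_def q_def)
  qed
  have "only_real_zeros (\<Sum>i\<le>k. smult (a i) (q i))"
    using two[of "\<lambda>_. 1"] p(2) by simp
  then have "only_real_zeros (\<Sum>i\<le>k. smult (a i * \<gamma> i) (q i))"
    using \<gamma> unfolding multiplier_sequences_def by blast
  then show ?thesis
    by (simp add: two)
qed

text \<open>
  When the coefficient at \<open>k\<close> is annihilated, only the multiple \<open>\<gamma> j\<close> of a basis element of degree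
  \<open>j\<close> remains, and for \<open>j \<ge> 2\<close> that element may have non-real zeros.
\<close>
lemma vanishes_before_zero:
  assumes ms: "\<And>q. simple_set q \<Longrightarrow> \<gamma> \<in> multiplier_sequences q"
    and "2 \<le> j" "j < k" "\<gamma> k = 0"
  shows "\<gamma> j = 0"
proof (rule ccontr)
  assume nz: "\<gamma> j \<noteq> 0"
  obtain s :: "real poly"
    where s: "degree s = 0" "\<not> only_real_zeros (monom 1 j + s)"
    using nonreal_perturbation[of 0 j] assms(2) by auto
  have deg: "degree (monom 1 j + s) = j"
    using s(1) assms(2) by (subst degree_add_eq_left) (auto simp: degree_monom_eq)
  then have "monom 1 j + s \<noteq> 0"
    using assms(2) by auto
  then have "only_real_zeros (smult (\<gamma> j) (monom 1 j + s))"
    using two_term_image_real[OF ms assms(3) _ only_real_zeros_monom _ deg] assms(4)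
    by (simp add: degree_monom_eq)
  then show False
    using only_real_zeros_smultD nz s(2) by blast
qed

text \<open>
  The image of \<open>x ^ k\<close> differs from \<open>\<gamma> k x ^ k\<close> by \<open>\<gamma> j - \<gamma> k\<close> times an arbitrary polynomial of
  degree \<open>j\<close>, so any discrepancy between \<open>\<gamma> j\<close> and \<open>\<gamma> k\<close> can be used to perturb \<open>x ^ k\<close>
  away from real-rootedness.
\<close>
lemma equal_before_nonzero:
  assumes ms: "\<And>q. simple_set q \<Longrightarrow> \<gamma> \<in> multiplier_sequences q"
    and "2 \<le> k" "j < k" "\<gamma> k \<noteq> 0"
  shows "\<gamma> j = \<gamma> k"
proof (rule ccontr)
  assume ne: "\<gamma> j \<noteq> \<gamma> k"
  obtain r :: "real poly"
    where r: "r \<noteq> 0" "degree r = j" "\<not> only_real_zeros (monom 1 k + r)"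
    using nonreal_perturbation[OF assms(3,2)] .
  \<comment> \<open>The scaling makes the image \<open>\<gamma> k x ^ k + (\<gamma> j - \<gamma> k) (c r)\<close> proportional to \<open>x ^ k + r\<close>.\<close>
  define c where "c = \<gamma> k / (\<gamma> j - \<gamma> k)"
  have c: "c \<noteq> 0" "(\<gamma> j - \<gamma> k) * c = \<gamma> k"
    using ne assms(4) by (auto simp: c_def)
  have "only_real_zeros
      (smult (\<gamma> k) (monom 1 k - smult c r) + smult (\<gamma> j) (smult c r))"
    using two_term_image_real[OF ms assms(3) _ only_real_zeros_monom, where r = "smult c r"] r c(1)
    by (simp add: degree_monom_eq)
  also have "smult (\<gamma> k) (monom 1 k - smult c r) + smult (\<gamma> j) (smult c r)
      = smult (\<gamma> k) (monom 1 k) + smult ((\<gamma> j - \<gamma> k) * c) r"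
    by (simp add: smult_diff_right smult_diff_left left_diff_distrib)
  also have "\<dots> = smult (\<gamma> k) (monom 1 k + r)"
    unfolding c(2) by (simp add: smult_add_right)
  finally show False
    using only_real_zeros_smultD assms(4) r(3) by blast
qed

theorem theorem5:
  fixes S :: "(nat \<Rightarrow> real) set" and \<gamma> :: "nat \<Rightarrow> real"
  assumes "S = (\<Inter>q\<in>{q. simple_set q}. multiplier_sequences q)"
    and "\<gamma> \<in> S"
  shows "(\<exists>c. \<forall>k. \<gamma> k = c) \<or> (\<forall>k\<ge>2. \<gamma> k = 0)"
proof (rule disjCI)
  have ms: "\<gamma> \<in> multiplier_sequences q" if "simple_set q" for q
    using assms that by auto
  assume "\<not> (\<forall>k\<ge>2. \<gamma> k = 0)"
  then obtain m where m: "2 \<le> m" "\<gamma> m \<noteq> 0"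
    by auto
  have "\<gamma> k = \<gamma> m" for k
  proof (cases k m rule: linorder_cases)
    case less
    then show ?thesis
      using equal_before_nonzero[OF ms m(1) _ m(2)] by simp
  next
    case greater
    then have "\<gamma> k \<noteq> 0"
      using vanishes_before_zero[OF ms m(1)] m(2) by blast
    then show ?thesis
      using equal_before_nonzero[OF ms, of k m] greater m(1) by simp
  qed simp
  then show "\<exists>c. \<forall>k. \<gamma> k = c"
    by blast
qed

end
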